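(* Suppose that $G$, $G'$, $G''$ are finite groups and that $\Psi=(|\psi_{a,b}\rangle)_{a\in G,b\in G'}$ and $\Psi'=(|\psi'_{b,c}\rangle)_{b\in G',c\in G''}$ are $(G,G')$-invariant and $(G',G'')$-invariant quantum Latin squares respectively, and let $U$ and $U'$ be their respective transformation matrices. Then the composition $\Psi\circ\Psi'$ is a $(G,G'')$-invariant quantum Latin square with transformation matrix equal to $UU'$.
   Context: A quantum Latin square is an $n\times n$ array of vectors from an $n$-dimensional complex inner product space $V$ such that the entries of each row and of each column form an orthonormal basis of $V$. The space $V$ may be an $n$-dimensional subspace of a larger inner product space; i.e., the requirement is that there is a common $n$-dimensional subspace of which every row and every column is an orthonormal basis. For finite groups $G,G'$, a quantum Latin square $\Psi=(|\psi_{a,b}\rangle)$ is $(G,G')$-invariant if its rows are indexed by $G$ and its columns by $G'$ and $\langle\psi_{a,b}|\psi_{c,d}\rangle$ depends only on $a^{-1}c\in G$ and $b^{-1}d\in G'$ (so $|G|=|G'|$). Inner products are conjugate-linear in the first argument. Its transformation matrix is the $G\times G'$ matrix with $(x,y)$-entry $\langle\psi_{a,b}|\psi_{c,d}\rangle$ for any $a,c\in G$, $b,d\in G'$ with $a^{-1}c=x$, $b^{-1}d=y$. The composition of two quantum Latin squares $\Psi=(|\psi_{i,j}\rangle)$ and $\Psi'=(|\psi'_{j,k}\rangle)$ of size $n\times n$ (the columns of $\Psi$ and the rows of $\Psi'$ having the same index set) is the $n\times n$ array $\Psi\circ\Psi'$ with $(i,k)$-entry $\frac{1}{\sqrt n}\sum_{j}|\psi_{i,j}\rangle\otimes|\psi'_{j,k}\rangle$.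 *)

theory Defs
  imports "HOL-Analysis.Cartesian_Space" "HOL-Algebra.Group"
begin

(* The ambient space is a whole type; it may have arbitrary dimension. *)
locale complex_inner_product_space = vector_space scale
  for scale :: "complex \<Rightarrow> 'v::ab_group_add \<Rightarrow> 'v" +
  fixes ip :: "'v \<Rightarrow> 'v \<Rightarrow> complex"
  assumes ip_add_right: "ip x (y + z) = ip x y + ip x z"
    and ip_scale_right: "ip x (scale c y) = c * ip x y"
    and ip_commute: "ip x y = cnj (ip y x)"
    and ip_pos: "x \<noteq> 0 \<Longrightarrow> 0 < Re (ip x x)"
begin

definition orthonormal_basis :: "'i set \<Rightarrow> ('i \<Rightarrow> 'v) \<Rightarrow> 'v set \<Rightarrow> bool" where
  "orthonormal_basis I f V \<longleftrightarrow>
     (\<forall>i\<in>I. \<forall>j\<in>I. ip (f i) (f j) = (if i = j then 1 else 0)) \<and> span (f ` I) = V"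

definition quantum_latin_square :: "'i set \<Rightarrow> 'j set \<Rightarrow> ('i \<Rightarrow> 'j \<Rightarrow> 'v) \<Rightarrow> bool" where
  "quantum_latin_square I J \<psi> \<longleftrightarrow>
     finite I \<and> finite J \<and> card I = card J \<and>
     (\<exists>V. subspace V \<and> dim V = card I \<and>
        (\<forall>i\<in>I. orthonormal_basis J (\<lambda>j. \<psi> i j) V) \<and>
        (\<forall>j\<in>J. orthonormal_basis I (\<lambda>i. \<psi> i j) V))"

definition invariant_quantum_latin_square ::
  "('g, 'm) monoid_scheme \<Rightarrow> ('h, 'n) monoid_scheme \<Rightarrow> ('g \<Rightarrow> 'h \<Rightarrow> 'v) \<Rightarrow> bool" where
  "invariant_quantum_latin_square G H \<psi> \<longleftrightarrow>
     quantum_latin_square (carrier G) (carrier H) \<psi> \<and>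
     (\<forall>a\<in>carrier G. \<forall>c\<in>carrier G. \<forall>a'\<in>carrier G. \<forall>c'\<in>carrier G.
      \<forall>b\<in>carrier H. \<forall>d\<in>carrier H. \<forall>b'\<in>carrier H. \<forall>d'\<in>carrier H.
        inv\<^bsub>G\<^esub> a \<otimes>\<^bsub>G\<^esub> c = inv\<^bsub>G\<^esub> a' \<otimes>\<^bsub>G\<^esub> c' \<longrightarrow>
        inv\<^bsub>H\<^esub> b \<otimes>\<^bsub>H\<^esub> d = inv\<^bsub>H\<^esub> b' \<otimes>\<^bsub>H\<^esub> d' \<longrightarrow>
        ip (\<psi> a b) (\<psi> c d) = ip (\<psi> a' b') (\<psi> c' d'))"

(* A G-by-H matrix is a function whose values outside the carriers are irrelevant.
   On the carriers, U is uniquely determined by this relation. *)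
definition transformation_matrix ::
  "('g, 'm) monoid_scheme \<Rightarrow> ('h, 'n) monoid_scheme \<Rightarrow> ('g \<Rightarrow> 'h \<Rightarrow> 'v) \<Rightarrow>
   ('g \<Rightarrow> 'h \<Rightarrow> complex) \<Rightarrow> bool" where
  "transformation_matrix G H \<psi> U \<longleftrightarrow>
     (\<forall>x\<in>carrier G. \<forall>y\<in>carrier H.
      \<forall>a\<in>carrier G. \<forall>c\<in>carrier G. \<forall>b\<in>carrier H. \<forall>d\<in>carrier H.
        inv\<^bsub>G\<^esub> a \<otimes>\<^bsub>G\<^esub> c = x \<longrightarrow> inv\<^bsub>H\<^esub> b \<otimes>\<^bsub>H\<^esub> d = y \<longrightarrow>
        U x y = ip (\<psi> a b) (\<psi> c d))"

end

(* The tensor product of two inner product spaces, up to isometric isomorphism: the inner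
   product on simple tensors and bilinearity determine it on the algebraic tensor product,
   where it is positive definite, so the induced linear map from there to the third space is
   injective; by the spanning condition it is onto. *)
locale inner_product_tensor =
  V: complex_inner_product_space scaleV ipV +
  W: complex_inner_product_space scaleW ipW +
  T: complex_inner_product_space scaleT ipT
  for scaleV :: "complex \<Rightarrow> 'v::ab_group_add \<Rightarrow> 'v" and ipV
    and scaleW :: "complex \<Rightarrow> 'w::ab_group_add \<Rightarrow> 'w" and ipW
    and scaleT :: "complex \<Rightarrow> 't::ab_group_add \<Rightarrow> 't" and ipT +
  fixes tensor :: "'v \<Rightarrow> 'w \<Rightarrow> 't"
  assumes tensor_linear_left: "Vector_Spaces.linear scaleV scaleT (\<lambda>v. tensor v w)"
    and tensor_linear_right: "Vector_Spaces.linear scaleW scaleT (\<lambda>w. tensor v w)"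
    and ip_tensor: "ipT (tensor v w) (tensor v' w') = ipV v v' * ipW w w'"
    and span_tensor: "T.span {tensor v w | v w. True} = UNIV"

definition qls_composition ::
  "(complex \<Rightarrow> 't::ab_group_add \<Rightarrow> 't) \<Rightarrow> ('v \<Rightarrow> 'w \<Rightarrow> 't) \<Rightarrow> 'j set \<Rightarrow>
   ('i \<Rightarrow> 'j \<Rightarrow> 'v) \<Rightarrow> ('j \<Rightarrow> 'k \<Rightarrow> 'w) \<Rightarrow> 'i \<Rightarrow> 'k \<Rightarrow> 't" where
  "qls_composition scaleT tensor J \<psi> \<psi>' i k =
     scaleT (complex_of_real (1 / sqrt (real (card J)))) (\<Sum>j\<in>J. tensor (\<psi> i j) (\<psi>' j k))"

definition matrix_product ::
  "'j set \<Rightarrow> ('i \<Rightarrow> 'j \<Rightarrow> complex) \<Rightarrow> ('j \<Rightarrow> 'k \<Rightarrow> complex) \<Rightarrow> 'i \<Rightarrow> 'k \<Rightarrow> complex" where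
  "matrix_product J U U' i k = (\<Sum>j\<in>J. U i j * U' j k)"

text \<open>The Kronecker product of coordinate spaces is an instance.\<close>

definition vec_ip :: "complex ^ 'm \<Rightarrow> complex ^ 'm \<Rightarrow> complex" where
  "vec_ip x y = (\<Sum>i\<in>UNIV. cnj (x $ i) * y $ i)"

lemma complex_inner_product_space_vec:
  "complex_inner_product_space ((*s) :: complex \<Rightarrow> complex ^ 'm \<Rightarrow> _) vec_ip"
proof
  fix x y z :: "complex ^ 'm" and c :: complex
  show "vec_ip x (y + z) = vec_ip x y + vec_ip x z"
    by (simp add: vec_ip_def algebra_simps sum.distrib)
  show "vec_ip x (c *s y) = c * vec_ip x y"
    by (simp add: vec_ip_def sum_distrib_left algebra_simps)
  show "vec_ip x y = cnj (vec_ip y x)"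
    by (simp add: vec_ip_def mult.commute)
  assume "x \<noteq> 0"
  then obtain i where i: "x $ i \<noteq> 0"
    by (auto simp: vec_eq_iff)
  have eq: "Re (vec_ip x x) = (\<Sum>i\<in>UNIV. (cmod (x $ i))\<^sup>2)"
    unfolding vec_ip_def cmod_power2 by (simp add: power2_eq_square)
  have "0 < (cmod (x $ i))\<^sup>2"
    using i by simp
  also have "\<dots> \<le> (\<Sum>i\<in>UNIV. (cmod (x $ i))\<^sup>2)"
    by (rule member_le_sum) auto
  finally show "0 < Re (vec_ip x x)"
    using eq by simp
qed

lemma inner_product_tensor_kronecker:
  "inner_product_tensor (*s) vec_ip (*s) vec_ip (*s) vec_ip
     (\<lambda>(v :: complex ^ 'm) (w :: complex ^ 'n). \<chi> p. v $ fst p * w $ snd p)"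
  (is "inner_product_tensor _ _ _ _ _ _ ?t")
proof -
  interpret V: complex_inner_product_space "(*s)" "vec_ip :: complex ^ 'm \<Rightarrow> _"
    by (rule complex_inner_product_space_vec)
  interpret W: complex_inner_product_space "(*s)" "vec_ip :: complex ^ 'n \<Rightarrow> _"
    by (rule complex_inner_product_space_vec)
  interpret T: complex_inner_product_space "(*s)" "vec_ip :: complex ^ ('m \<times> 'n) \<Rightarrow> _"
    by (rule complex_inner_product_space_vec)
  have "z \<in> vec.span {?t v w | v w. True}" for z :: "complex ^ ('m \<times> 'n)"
  proof -
    have ax: "?t (axis (fst p) 1) (axis (snd p) 1) = axis p 1" for p :: "'m \<times> 'n"
      by (auto simp: vec_eq_iff axis_def prod_eq_iff)
    have mem: "axis p 1 \<in> {?t v w | v w. True}" for p :: "'m \<times> 'n"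
      using ax[of p, symmetric] by blast
    have "z = (\<Sum>p\<in>UNIV. z $ p *s axis p 1)"
      by (simp add: basis_expansion)
    also have "\<dots> \<in> vec.span {?t v w | v w. True}"
      by (intro vec.span_sum vec.span_scale vec.span_base mem)
    finally show ?thesis .
  qed
  moreover have "vec_ip (?t v w) (?t v' w') = vec_ip v v' * vec_ip w w'" for v w v' w'
    by (simp add: vec_ip_def sum_product sum.cartesian_product split_def algebra_simps
        flip: UNIV_Times_UNIV)
  ultimately show ?thesis
    by unfold_locales (auto simp: vec_eq_iff algebra_simps)
qed

end

theory Submission imports Defs
begin

text \<open>The Gram matrix of the composition is a double sum over \<open>j, j'\<close> of
  \<open>U x (j\<inverse>j') * U' (j\<inverse>j') z / n\<close>; substituting \<open>y = j\<inverse>j'\<close> turns it into \<open>U U'\<close>. Rows and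
  columns are then orthonormal because those of \<open>\<psi>\<close> and \<open>\<psi>'\<close> are. They all span the same space:
  expanding \<open>\<psi> a' j'\<close> and \<open>\<psi>' j' c'\<close> in the rows \<open>a\<close> and \<open>j\<close> and summing over \<open>j'\<close> first expresses
  every entry of the composition through row \<open>a\<close>, and likewise for columns.\<close>

section \<open>Orthonormal bases and quantum Latin squares in one inner product space\<close>

context complex_inner_product_space
begin

lemma ip_zero_right [simp]: "ip x 0 = 0"
  using ip_scale_right[of x 0 0] by simp

lemma ip_sum_right: "ip x (\<Sum>i\<in>I. f i) = (\<Sum>i\<in>I. ip x (f i))"
  by (induction I rule: infinite_finite_induct) (auto simp: ip_add_right)

lemma ip_sum_left: "ip (\<Sum>i\<in>I. f i) x = (\<Sum>i\<in>I. ip (f i) x)"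
  using ip_commute by (metis (no_types, lifting) cnj_sum ip_sum_right sum.cong)

lemma ip_scale_left: "ip (scale c x) y = cnj c * ip x y"
  using ip_commute by (metis complex_cnj_mult ip_scale_right)

text \<open>The vectors that equal their own expansion form a subspace. By orthonormality it
  contains every \<open>f j\<close>, hence all of the span.\<close>

lemma orthonormal_basis_expansion:
  assumes "finite I" and on: "orthonormal_basis I f V" and "v \<in> V"
  shows "v = (\<Sum>i\<in>I. scale (ip (f i) v) (f i))"
proof -
  have "v \<in> span (f ` I)"
    using assms by (simp add: orthonormal_basis_def)
  then have "(\<Sum>i\<in>I. scale (ip (f i) v) (f i)) = v"
  proof (induction rule: span_induct)
    case base
    show ?case
    proof (rule subspaceI)
      let ?e = "\<lambda>x. \<Sum>i\<in>I. scale (ip (f i) x) (f i)"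
      have "?e (x + y) = ?e x + ?e y" for x y
        by (simp add: ip_add_right scale_left_distrib sum.distrib)
      then show "x + y \<in> {v. ?e v = v}" if "x \<in> {v. ?e v = v}" "y \<in> {v. ?e v = v}" for x y
        using that by simp
      have "?e (scale c x) = scale c (?e x)" for c x
        by (simp add: ip_scale_right scale_sum_right)
      then show "scale c x \<in> {v. ?e v = v}" if "x \<in> {v. ?e v = v}" for c x
        using that by simp
    qed simp
  next
    case (step x)
    then obtain j where j: "j \<in> I" "x = f j"
      by blast
    have "(\<Sum>i\<in>I. scale (ip (f i) x) (f i)) = (\<Sum>i\<in>I. if i = j then f i else 0)"
      using on j by (intro sum.cong) (auto simp: orthonormal_basis_def)
    then show ?case
      using j \<open>finite I\<close> by simp
  qed
  then show ?thesis ..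
qed

text \<open>Pairing a vanishing linear combination with \<open>f j\<close> isolates the coefficient
  of \<open>f j\<close>, so the family is independent. This supplies the dimension clause of
  \<open>quantum_latin_square\<close>.\<close>

lemma orthonormal_basis_dim:
  assumes "finite I" and on: "orthonormal_basis I f V"
  shows "dim V = card I"
proof -
  have ip: "ip (f i) (f j) = (if i = j then 1 else 0)" if "i \<in> I" "j \<in> I" for i j
    using on that by (simp add: orthonormal_basis_def)
  \<comment> \<open>If \<open>f i = f j\<close> with \<open>i \<noteq> j\<close>, then
    \<open>ip (f i) (f j)\<close> would be both 1 and 0.\<close>
  have inj: "inj_on f I"
    by (rule inj_onI) (metis ip zero_neq_one)
  have "independent (f ` I)"
  proof (rule independent_if_scalars_zero)
    fix g x
    assume 0: "(\<Sum>x\<in>f ` I. scale (g x) x) = 0" and "x \<in> f ` I"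
    then obtain j where j: "j \<in> I" "x = f j"
      by blast
    have "0 = ip x (\<Sum>i\<in>I. scale (g (f i)) (f i))"
      using 0 inj by (simp add: sum.reindex)
    also have "\<dots> = (\<Sum>i\<in>I. if i = j then g x else 0)"
      unfolding ip_sum_right using j by (intro sum.cong) (auto simp: ip_scale_right ip)
    finally show "g x = 0"
      using j \<open>finite I\<close> by simp
  qed (simp add: \<open>finite I\<close>)
  then have "dim V = card (f ` I)"
    using on by (intro dim_eq_card) (auto simp: orthonormal_basis_def span_span)
  then show ?thesis
    using inj by (simp add: card_image)
qed

text \<open>This trades the existential over a common subspace for membership conditions: once each
  row and each column spans every entry, the span of all entries serves as the subspace.
  Nonemptiness of \<open>I\<close> provides a row from which its dimension is computed.\<close>

lemma quantum_latin_squareI: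
  assumes fin: "finite I" "finite J" "card I = card J" "I \<noteq> {}"
    and row: "\<And>i j j'. i \<in> I \<Longrightarrow> j \<in> J \<Longrightarrow> j' \<in> J \<Longrightarrow>
      ip (\<psi> i j) (\<psi> i j') = (if j = j' then 1 else 0)"
    and col: "\<And>i i' j. i \<in> I \<Longrightarrow> i' \<in> I \<Longrightarrow> j \<in> J \<Longrightarrow>
      ip (\<psi> i j) (\<psi> i' j) = (if i = i' then 1 else 0)"
    and row_span: "\<And>i i' j'. i \<in> I \<Longrightarrow> i' \<in> I \<Longrightarrow> j' \<in> J \<Longrightarrow> \<psi> i' j' \<in> span (\<psi> i ` J)"
    and col_span: "\<And>j i' j'. j \<in> J \<Longrightarrow> i' \<in> I \<Longrightarrow> j' \<in> J \<Longrightarrow>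
      \<psi> i' j' \<in> span ((\<lambda>i. \<psi> i j) ` I)"
  shows "quantum_latin_square I J \<psi>"
proof -
  let ?V = "span {\<psi> i j | i j. i \<in> I \<and> j \<in> J}"
  have rows: "orthonormal_basis J (\<lambda>j. \<psi> i j) ?V" if "i \<in> I" for i
    unfolding orthonormal_basis_def
    by (intro conjI ballI antisym span_mono span_minimal subspace_span)
      (use row row_span that in auto)
  have cols: "orthonormal_basis I (\<lambda>i. \<psi> i j) ?V" if "j \<in> J" for j
    unfolding orthonormal_basis_def
    by (intro conjI ballI antisym span_mono span_minimal subspace_span)
      (use col col_span that in auto)
  obtain i where "i \<in> I"
    using \<open>I \<noteq> {}\<close> by blast
  \<comment> \<open>Row \<open>i\<close> is a basis indexed by \<open>J\<close>, so the dimension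
    comes out as \<open>card J\<close>, which equals \<open>card I\<close>.\<close>
  then have "dim ?V = card I"
    using orthonormal_basis_dim[OF _ rows] fin by auto
  then show ?thesis
    unfolding quantum_latin_square_def using fin rows cols by (intro conjI exI[of _ ?V]) auto
qed

lemma quantum_latin_squareD:
  assumes "quantum_latin_square I J \<psi>"
  shows "i \<in> I \<Longrightarrow> j \<in> J \<Longrightarrow> j' \<in> J \<Longrightarrow> ip (\<psi> i j) (\<psi> i j') = (if j = j' then 1 else 0)"
    and "i \<in> I \<Longrightarrow> i' \<in> I \<Longrightarrow> j \<in> J \<Longrightarrow> ip (\<psi> i j) (\<psi> i' j) = (if i = i' then 1 else 0)"
  using assms unfolding quantum_latin_square_def orthonormal_basis_def by blast+

text \<open>An entry lies in the subspace spanned by its own row. Every other row and every column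
  is an orthonormal basis of that same subspace, so the entry can be expanded in any of
  them.\<close>

lemma quantum_latin_square_expansion:
  assumes qls: "quantum_latin_square I J \<psi>" and ij: "i' \<in> I" "j' \<in> J"
  shows "i \<in> I \<Longrightarrow> \<psi> i' j' = (\<Sum>j\<in>J. scale (ip (\<psi> i j) (\<psi> i' j')) (\<psi> i j))"
    and "j \<in> J \<Longrightarrow> \<psi> i' j' = (\<Sum>i\<in>I. scale (ip (\<psi> i j) (\<psi> i' j')) (\<psi> i j))"
proof -
  obtain V where fin: "finite I" "finite J"
    and rows: "\<And>i. i \<in> I \<Longrightarrow> orthonormal_basis J (\<psi> i) V"
    and cols: "\<And>j. j \<in> J \<Longrightarrow> orthonormal_basis I (\<lambda>i. \<psi> i j) V"
    using qls unfolding quantum_latin_square_def by blast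
  have "\<psi> i' j' \<in> span (\<psi> i' ` J)"
    using ij by (simp add: span_base)
  then have V: "\<psi> i' j' \<in> V"
    using rows[OF ij(1)] by (simp add: orthonormal_basis_def)
  show "i \<in> I \<Longrightarrow> \<psi> i' j' = (\<Sum>j\<in>J. scale (ip (\<psi> i j) (\<psi> i' j')) (\<psi> i j))"
    using orthonormal_basis_expansion[OF fin(2) rows V] .
  show "j \<in> J \<Longrightarrow> \<psi> i' j' = (\<Sum>i\<in>I. scale (ip (\<psi> i j) (\<psi> i' j')) (\<psi> i j))"
    using orthonormal_basis_expansion[OF fin(1) cols V] .
qed

lemma transformation_matrixD:
  assumes "group G" "group H" "transformation_matrix G H \<psi> U"
    and "a \<in> carrier G" "c \<in> carrier G" "b \<in> carrier H" "d \<in> carrier H"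
  shows "ip (\<psi> a b) (\<psi> c d) = U (inv\<^bsub>G\<^esub> a \<otimes>\<^bsub>G\<^esub> c) (inv\<^bsub>H\<^esub> b \<otimes>\<^bsub>H\<^esub> d)"
proof -
  interpret G: group G by fact
  interpret H: group H by fact
  have "inv\<^bsub>G\<^esub> a \<otimes>\<^bsub>G\<^esub> c \<in> carrier G" "inv\<^bsub>H\<^esub> b \<otimes>\<^bsub>H\<^esub> d \<in> carrier H"
    using assms by simp_all
  then show ?thesis
    using assms(3-) unfolding transformation_matrix_def by metis
qed

end

section \<open>Reindexing sums over a group\<close>

lemma (in group) sum_inv_mult_left:
  assumes "a \<in> carrier G"
  shows "(\<Sum>x\<in>carrier G. f (inv a \<otimes> x)) = (\<Sum>x\<in>carrier G. f x)"
  by (rule sum.reindex_bij_witness[of _ "\<lambda>x. a \<otimes> x" "\<lambda>x. inv a \<otimes> x"])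
    (use assms in \<open>simp_all add: m_assoc[symmetric]\<close>)

text \<open>The map \<open>x \<mapsto> inv x \<otimes> a\<close> is a bijection of the carrier with
  inverse \<open>y \<mapsto> a \<otimes> inv y\<close>. This form serves the Gram matrix, where the
  inverted index is summed; the span arguments sum over the other index and use
  \<open>sum_inv_mult_left\<close>.\<close>

lemma (in group) sum_mult_inv_right:
  assumes "a \<in> carrier G"
  shows "(\<Sum>x\<in>carrier G. f (inv x \<otimes> a)) = (\<Sum>x\<in>carrier G. f x)"
proof (rule sum.reindex_bij_witness[of _ "\<lambda>x. a \<otimes> inv x" "\<lambda>x. inv x \<otimes> a"])
  fix x assume x: "x \<in> carrier G"
  show "a \<otimes> inv (inv x \<otimes> a) = x"
    using x assms by (simp add: inv_mult_group m_assoc[symmetric])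
  show "inv (a \<otimes> inv x) \<otimes> a = x"
    using x assms by (simp add: inv_mult_group m_assoc)
qed (use assms in auto)

lemma (in group) inv_mult_eq_one_iff:
  assumes "a \<in> carrier G" "b \<in> carrier G"
  shows "inv a \<otimes> b = \<one> \<longleftrightarrow> a = b"
  using assms by (metis inv_closed inv_equality inv_inv l_inv)

section \<open>Gram matrix, spans and orthonormality of the composition\<close>

context inner_product_tensor
begin

lemma tensor_scale_sum_left:
  "tensor (\<Sum>i\<in>I. scaleV (u i) (f i)) w = (\<Sum>i\<in>I. scaleT (u i) (tensor (f i) w))"
proof -
  interpret L: Vector_Spaces.linear scaleV scaleT "\<lambda>v. tensor v w"
    by (rule tensor_linear_left)
  show ?thesis
    by (simp add: L.sum L.scale)
qed

lemma tensor_scale_sum_right: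
  "tensor v (\<Sum>i\<in>I. scaleW (u i) (f i)) = (\<Sum>i\<in>I. scaleT (u i) (tensor v (f i)))"
proof -
  interpret L: Vector_Spaces.linear scaleW scaleT "\<lambda>w. tensor v w"
    by (rule tensor_linear_right)
  show ?thesis
    by (simp add: L.sum L.scale)
qed

text \<open>Both the invariance and the orthonormality of the composition are read off from this
  Gram matrix. The double sum over \<open>carrier H\<close> yields the matrix product once for each
  \<open>j'\<close>, and these \<open>card (carrier H)\<close> copies cancel the two normalising
  factors.\<close>

lemma ip_qls_composition:
  assumes "group G" and H: "group H" "finite (carrier H)" and "group K"
    and tm: "V.transformation_matrix G H \<psi> U" "W.transformation_matrix H K \<psi>' U'"
    and ac: "a \<in> carrier G" "a' \<in> carrier G" "c \<in> carrier K" "c' \<in> carrier K"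
  shows "ipT (qls_composition scaleT tensor (carrier H) \<psi> \<psi>' a c)
      (qls_composition scaleT tensor (carrier H) \<psi> \<psi>' a' c') =
    matrix_product (carrier H) U U' (inv\<^bsub>G\<^esub> a \<otimes>\<^bsub>G\<^esub> a') (inv\<^bsub>K\<^esub> c \<otimes>\<^bsub>K\<^esub> c')"
    (is "?ip = matrix_product _ _ _ ?x ?z")
proof -
  interpret H: group H by fact
  note V_tm = V.transformation_matrixD[OF assms(1) H(1) tm(1)]
    and W_tm = W.transformation_matrixD[OF H(1) assms(4) tm(2)]
  let ?n = "card (carrier H)"
  let ?s = "complex_of_real (1 / sqrt (real ?n))"
  \<comment> \<open>A group is never empty, so the normalising factor is a genuine inverse square
    root and its square cancels \<open>?n\<close>.\<close>
  have "?n > 0"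
    using H by (auto simp: card_gt_0_iff)
  then have "1 / sqrt (real ?n) * (1 / sqrt (real ?n)) * real ?n = 1"
    by (simp add: field_simps)
  then have s: "cnj ?s * ?s * of_nat ?n = 1"
    by (metis complex_cnj_complex_of_real of_real_1 of_real_mult of_real_of_nat_eq)
  \<comment> \<open>The outer index \<open>j'\<close> belongs to the second argument of
    \<open>ipT\<close>. The inner sum then runs over the index \<open>j\<close> that gets inverted,
    as \<open>sum_mult_inv_right\<close> requires.\<close>
  have "?ip = cnj ?s * ?s * (\<Sum>j'\<in>carrier H. \<Sum>j\<in>carrier H.
      ipV (\<psi> a j) (\<psi> a' j') * ipW (\<psi>' j c) (\<psi>' j' c'))"
    unfolding qls_composition_def
    by (simp only: T.ip_scale_left T.ip_scale_right T.ip_sum_left T.ip_sum_right ip_tensor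
        mult.assoc flip: sum_distrib_left) (simp only: mult.left_commute)
  also have "(\<Sum>j'\<in>carrier H. \<Sum>j\<in>carrier H.
      ipV (\<psi> a j) (\<psi> a' j') * ipW (\<psi>' j c) (\<psi>' j' c')) =
    (\<Sum>j'\<in>carrier H. \<Sum>j\<in>carrier H.
      U ?x (inv\<^bsub>H\<^esub> j \<otimes>\<^bsub>H\<^esub> j') * U' (inv\<^bsub>H\<^esub> j \<otimes>\<^bsub>H\<^esub> j') ?z)"
    using ac by (intro sum.cong) (simp_all add: V_tm W_tm)
  \<comment> \<open>After substituting \<open>y\<close> for \<open>inv j \<otimes> j'\<close>, the
    inner sum no longer depends on \<open>j'\<close>, so the outer sum only multiplies by
    \<open>?n\<close>.\<close>
  also have "\<dots> = of_nat ?n * matrix_product (carrier H) U U' ?x ?z"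
    by (simp add: H.sum_mult_inv_right[where f = "\<lambda>y. U ?x y * U' y ?z"] matrix_product_def)
  finally show ?thesis
    using s by (simp only: mult.assoc[symmetric] mult_1)
qed

lemma transformation_matrix_qls_composition:
  assumes "group G" "group H" "finite (carrier H)" "group K"
    and "V.transformation_matrix G H \<psi> U" "W.transformation_matrix H K \<psi>' U'"
  shows "T.transformation_matrix G K (qls_composition scaleT tensor (carrier H) \<psi> \<psi>')
    (matrix_product (carrier H) U U')"
  unfolding T.transformation_matrix_def using ip_qls_composition[OF assms] by auto

text \<open>Expanding \<open>\<psi> a' j'\<close> in row \<open>a\<close> produces an index
  \<open>j\<close>, and \<open>\<psi>' j' c'\<close> is then expanded in the row with that same
  \<open>j\<close>. Thus only the matched tensors \<open>tensor (\<psi> a j) (\<psi>' j c)\<close>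
  occur, which are the ones that make up \<open>\<Phi> a c\<close>.\<close>

lemma qls_composition_in_row_span:
  assumes "group G" and H: "group H" "finite (carrier H)" and "group K"
    and qls: "V.quantum_latin_square (carrier G) (carrier H) \<psi>"
      "W.quantum_latin_square (carrier H) (carrier K) \<psi>'"
    and tm: "V.transformation_matrix G H \<psi> U" "W.transformation_matrix H K \<psi>' U'"
    and ac: "a \<in> carrier G" "a' \<in> carrier G" "c' \<in> carrier K"
  defines "\<Phi> \<equiv> qls_composition scaleT tensor (carrier H) \<psi> \<psi>'"
  shows "\<Phi> a' c' \<in> T.span (\<Phi> a ` carrier K)"
proof -
  interpret H: group H by fact
  note V_tm = V.transformation_matrixD[OF assms(1) H(1) tm(1)]
    and W_tm = W.transformation_matrixD[OF H(1) assms(4) tm(2)]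
  let ?s = "complex_of_real (1 / sqrt (real (card (carrier H))))"
  let ?x = "inv\<^bsub>G\<^esub> a \<otimes>\<^bsub>G\<^esub> a'" and ?z = "\<lambda>c. inv\<^bsub>K\<^esub> c \<otimes>\<^bsub>K\<^esub> c'"
  \<comment> \<open>This is the product of the two expansion coefficients. Its dependence on
    \<open>j\<close> and \<open>j'\<close> is only through
    \<open>inv j \<otimes> j'\<close>.\<close>
  let ?w = "\<lambda>j j' c. U ?x (inv\<^bsub>H\<^esub> j \<otimes>\<^bsub>H\<^esub> j') * U' (inv\<^bsub>H\<^esub> j \<otimes>\<^bsub>H\<^esub> j') (?z c)"
  have "tensor (\<psi> a' j') (\<psi>' j' c') = (\<Sum>j\<in>carrier H. \<Sum>c\<in>carrier K.
      scaleT (?w j j' c) (tensor (\<psi> a j) (\<psi>' j c)))" if j': "j' \<in> carrier H" for j'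
  proof -
    have "tensor (\<psi> a' j') (\<psi>' j' c') = (\<Sum>j\<in>carrier H.
        scaleT (ipV (\<psi> a j) (\<psi> a' j')) (tensor (\<psi> a j) (\<psi>' j' c')))"
      by (subst V.quantum_latin_square_expansion(1)[OF qls(1) ac(2) j' ac(1)])
        (rule tensor_scale_sum_left)
    also have "\<dots> = (\<Sum>j\<in>carrier H. \<Sum>c\<in>carrier K.
        scaleT (?w j j' c) (tensor (\<psi> a j) (\<psi>' j c)))"
    proof (rule sum.cong[OF refl])
      fix j assume j: "j \<in> carrier H"
      have "tensor (\<psi> a j) (\<psi>' j' c') = (\<Sum>c\<in>carrier K.
          scaleT (ipW (\<psi>' j c) (\<psi>' j' c')) (tensor (\<psi> a j) (\<psi>' j c)))"
        by (subst W.quantum_latin_square_expansion(1)[OF qls(2) j' ac(3) j])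
          (rule tensor_scale_sum_right)
      then show "scaleT (ipV (\<psi> a j) (\<psi> a' j')) (tensor (\<psi> a j) (\<psi>' j' c')) =
          (\<Sum>c\<in>carrier K. scaleT (?w j j' c) (tensor (\<psi> a j) (\<psi>' j c)))"
        using ac j j'
        by (simp add: T.scale_sum_right V_tm W_tm)
    qed
    finally show ?thesis .
  qed
  then have "\<Phi> a' c' = scaleT ?s (\<Sum>j'\<in>carrier H. \<Sum>j\<in>carrier H. \<Sum>c\<in>carrier K.
      scaleT (?w j j' c) (tensor (\<psi> a j) (\<psi>' j c)))"
    by (simp add: \<Phi>_def qls_composition_def)
  also have "(\<Sum>j'\<in>carrier H. \<Sum>j\<in>carrier H. \<Sum>c\<in>carrier K.
      scaleT (?w j j' c) (tensor (\<psi> a j) (\<psi>' j c))) =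
    (\<Sum>j\<in>carrier H. \<Sum>c\<in>carrier K. \<Sum>j'\<in>carrier H.
      scaleT (?w j j' c) (tensor (\<psi> a j) (\<psi>' j c)))"
    by (subst sum.swap, intro sum.cong refl, rule sum.swap)
  \<comment> \<open>For fixed \<open>j\<close>, summing the weights over \<open>j'\<close> is a sum
    over \<open>y = inv j \<otimes> j'\<close>, so the total coefficient is the same for every
    \<open>j\<close>.\<close>
  also have "\<dots> = (\<Sum>j\<in>carrier H. \<Sum>c\<in>carrier K.
      scaleT (matrix_product (carrier H) U U' ?x (?z c)) (tensor (\<psi> a j) (\<psi>' j c)))"
    by (intro sum.cong refl)
      (simp add: matrix_product_def T.scale_sum_left[symmetric]
        H.sum_inv_mult_left[where f = "\<lambda>y. U ?x y * U' y _"])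
  \<comment> \<open>As the coefficient is free of \<open>j\<close>, exchanging the sums collects the
    terms with a given \<open>c\<close> into a multiple of \<open>\<Phi> a c\<close>.\<close>
  also have "scaleT ?s \<dots> =
      (\<Sum>c\<in>carrier K. scaleT (matrix_product (carrier H) U U' ?x (?z c)) (\<Phi> a c))"
    by (subst sum.swap) (simp add: \<Phi>_def qls_composition_def T.scale_sum_right mult.commute)
  also have "\<dots> \<in> T.span (\<Phi> a ` carrier K)"
    by (intro T.span_sum T.span_scale T.span_base) auto
  finally show ?thesis .
qed

text \<open>The mirror image of the row argument, with the order of expansion reversed: column
  \<open>c\<close> of \<open>\<psi>'\<close> now produces the index \<open>j\<close>, which selects
  the column in which \<open>\<psi> a' j'\<close> is expanded.\<close>

lemma qls_composition_in_column_span: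
  assumes "group G" and H: "group H" "finite (carrier H)" and "group K"
    and qls: "V.quantum_latin_square (carrier G) (carrier H) \<psi>"
      "W.quantum_latin_square (carrier H) (carrier K) \<psi>'"
    and tm: "V.transformation_matrix G H \<psi> U" "W.transformation_matrix H K \<psi>' U'"
    and ac: "a' \<in> carrier G" "c \<in> carrier K" "c' \<in> carrier K"
  defines "\<Phi> \<equiv> qls_composition scaleT tensor (carrier H) \<psi> \<psi>'"
  shows "\<Phi> a' c' \<in> T.span ((\<lambda>a. \<Phi> a c) ` carrier G)"
proof -
  interpret H: group H by fact
  note V_tm = V.transformation_matrixD[OF assms(1) H(1) tm(1)]
    and W_tm = W.transformation_matrixD[OF H(1) assms(4) tm(2)]
  let ?s = "complex_of_real (1 / sqrt (real (card (carrier H))))"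
  let ?x = "\<lambda>a. inv\<^bsub>G\<^esub> a \<otimes>\<^bsub>G\<^esub> a'" and ?z = "inv\<^bsub>K\<^esub> c \<otimes>\<^bsub>K\<^esub> c'"
  let ?w = "\<lambda>j j' a. U (?x a) (inv\<^bsub>H\<^esub> j \<otimes>\<^bsub>H\<^esub> j') * U' (inv\<^bsub>H\<^esub> j \<otimes>\<^bsub>H\<^esub> j') ?z"
  have "tensor (\<psi> a' j') (\<psi>' j' c') = (\<Sum>j\<in>carrier H. \<Sum>a\<in>carrier G.
      scaleT (?w j j' a) (tensor (\<psi> a j) (\<psi>' j c)))" if j': "j' \<in> carrier H" for j'
  proof -
    have "tensor (\<psi> a' j') (\<psi>' j' c') = (\<Sum>j\<in>carrier H.
        scaleT (ipW (\<psi>' j c) (\<psi>' j' c')) (tensor (\<psi> a' j') (\<psi>' j c)))"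
      by (subst W.quantum_latin_square_expansion(2)[OF qls(2) j' ac(3) ac(2)])
        (rule tensor_scale_sum_right)
    also have "\<dots> = (\<Sum>j\<in>carrier H. \<Sum>a\<in>carrier G.
        scaleT (?w j j' a) (tensor (\<psi> a j) (\<psi>' j c)))"
    proof (rule sum.cong[OF refl])
      fix j assume j: "j \<in> carrier H"
      have "tensor (\<psi> a' j') (\<psi>' j c) = (\<Sum>a\<in>carrier G.
          scaleT (ipV (\<psi> a j) (\<psi> a' j')) (tensor (\<psi> a j) (\<psi>' j c)))"
        by (subst V.quantum_latin_square_expansion(2)[OF qls(1) ac(1) j' j])
          (rule tensor_scale_sum_left)
      then show "scaleT (ipW (\<psi>' j c) (\<psi>' j' c')) (tensor (\<psi> a' j') (\<psi>' j c)) =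
          (\<Sum>a\<in>carrier G. scaleT (?w j j' a) (tensor (\<psi> a j) (\<psi>' j c)))"
        using ac j j'
        by (simp add: T.scale_sum_right mult.commute V_tm W_tm)
    qed
    finally show ?thesis .
  qed
  then have "\<Phi> a' c' = scaleT ?s (\<Sum>j'\<in>carrier H. \<Sum>j\<in>carrier H. \<Sum>a\<in>carrier G.
      scaleT (?w j j' a) (tensor (\<psi> a j) (\<psi>' j c)))"
    by (simp add: \<Phi>_def qls_composition_def)
  also have "(\<Sum>j'\<in>carrier H. \<Sum>j\<in>carrier H. \<Sum>a\<in>carrier G.
      scaleT (?w j j' a) (tensor (\<psi> a j) (\<psi>' j c))) =
    (\<Sum>j\<in>carrier H. \<Sum>a\<in>carrier G. \<Sum>j'\<in>carrier H.
      scaleT (?w j j' a) (tensor (\<psi> a j) (\<psi>' j c)))"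
    by (subst sum.swap, intro sum.cong refl, rule sum.swap)
  also have "\<dots> = (\<Sum>j\<in>carrier H. \<Sum>a\<in>carrier G.
      scaleT (matrix_product (carrier H) U U' (?x a) ?z) (tensor (\<psi> a j) (\<psi>' j c)))"
    by (intro sum.cong refl)
      (simp add: matrix_product_def T.scale_sum_left[symmetric]
        H.sum_inv_mult_left[where f = "\<lambda>y. U _ y * U' y _"])
  \<comment> \<open>Again the coefficient is free of \<open>j\<close>; here the inner sum over
    \<open>j\<close> reassembles \<open>\<Phi> a c\<close> for each \<open>a\<close>.\<close>
  also have "scaleT ?s \<dots> =
      (\<Sum>a\<in>carrier G. scaleT (matrix_product (carrier H) U U' (?x a) ?z) (\<Phi> a c))"
    by (subst sum.swap) (simp add: \<Phi>_def qls_composition_def T.scale_sum_right mult.commute)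
  also have "\<dots> \<in> T.span ((\<lambda>a. \<Phi> a c) ` carrier G)"
    by (intro T.span_sum T.span_scale T.span_base) auto
  finally show ?thesis .
qed

text \<open>Orthonormality of rows and columns says that the identity row and the identity column of
  a transformation matrix are Kronecker deltas. This property passes from \<open>U\<close> and
  \<open>U'\<close> to their product, and the two span lemmas give the rest.\<close>

lemma quantum_latin_square_qls_composition:
  assumes "group G" and H: "group H" "finite (carrier H)" and "group K"
    and qls: "V.quantum_latin_square (carrier G) (carrier H) \<psi>"
      "W.quantum_latin_square (carrier H) (carrier K) \<psi>'"
    and tm: "V.transformation_matrix G H \<psi> U" "W.transformation_matrix H K \<psi>' U'"
  shows "T.quantum_latin_square (carrier G) (carrier K)
    (qls_composition scaleT tensor (carrier H) \<psi> \<psi>')"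
    (is "T.quantum_latin_square _ _ ?\<Phi>")
proof -
  interpret G: group G by fact
  interpret H: group H by fact
  interpret K: group K by fact
  \<comment> \<open>Two entries in the same row have first quotient \<open>\<one>\<close>, so row
    orthonormality of \<open>\<psi>\<close> determines \<open>U\<close> there; columns determine
    \<open>U\<close> at second argument \<open>\<one>\<close>. The same holds for
    \<open>\<psi>'\<close> and \<open>U'\<close>.\<close>
  have U_one: "U \<one>\<^bsub>G\<^esub> y = (if y = \<one>\<^bsub>H\<^esub> then 1 else 0)" if "y \<in> carrier H" for y
    using V.transformation_matrixD[OF assms(1) H(1) tm(1), of "\<one>\<^bsub>G\<^esub>" "\<one>\<^bsub>G\<^esub>" "\<one>\<^bsub>H\<^esub>" y]
      V.quantum_latin_squareD(1)[OF qls(1), of "\<one>\<^bsub>G\<^esub>" "\<one>\<^bsub>H\<^esub>" y] that by auto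
  have one_U: "U x \<one>\<^bsub>H\<^esub> = (if x = \<one>\<^bsub>G\<^esub> then 1 else 0)" if "x \<in> carrier G" for x
    using V.transformation_matrixD[OF assms(1) H(1) tm(1), of "\<one>\<^bsub>G\<^esub>" x "\<one>\<^bsub>H\<^esub>" "\<one>\<^bsub>H\<^esub>"]
      V.quantum_latin_squareD(2)[OF qls(1), of "\<one>\<^bsub>G\<^esub>" x "\<one>\<^bsub>H\<^esub>"] that by auto
  have U'_one: "U' \<one>\<^bsub>H\<^esub> z = (if z = \<one>\<^bsub>K\<^esub> then 1 else 0)" if "z \<in> carrier K" for z
    using W.transformation_matrixD[OF H(1) assms(4) tm(2), of "\<one>\<^bsub>H\<^esub>" "\<one>\<^bsub>H\<^esub>" "\<one>\<^bsub>K\<^esub>" z]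
      W.quantum_latin_squareD(1)[OF qls(2), of "\<one>\<^bsub>H\<^esub>" "\<one>\<^bsub>K\<^esub>" z] that by auto
  have one_U': "U' y \<one>\<^bsub>K\<^esub> = (if y = \<one>\<^bsub>H\<^esub> then 1 else 0)" if "y \<in> carrier H" for y
    using W.transformation_matrixD[OF H(1) assms(4) tm(2), of "\<one>\<^bsub>H\<^esub>" y "\<one>\<^bsub>K\<^esub>" "\<one>\<^bsub>K\<^esub>"]
      W.quantum_latin_squareD(2)[OF qls(2), of "\<one>\<^bsub>H\<^esub>" y "\<one>\<^bsub>K\<^esub>"] that by auto
  \<comment> \<open>In the identity row of the product only \<open>y = \<one>\<close> survives,
    leaving the identity row of \<open>U'\<close>.\<close>
  have "matrix_product (carrier H) U U' \<one>\<^bsub>G\<^esub> z =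
      (\<Sum>y\<in>carrier H. if y = \<one>\<^bsub>H\<^esub> then U' y z else 0)" for z
    unfolding matrix_product_def by (intro sum.cong) (auto simp: U_one)
  then have row: "matrix_product (carrier H) U U' \<one>\<^bsub>G\<^esub> z = (if z = \<one>\<^bsub>K\<^esub> then 1 else 0)"
    if "z \<in> carrier K" for z
    using that H by (simp add: U'_one)
  have "matrix_product (carrier H) U U' x \<one>\<^bsub>K\<^esub> =
      (\<Sum>y\<in>carrier H. if y = \<one>\<^bsub>H\<^esub> then U x y else 0)" for x
    unfolding matrix_product_def by (intro sum.cong) (auto simp: one_U')
  then have col: "matrix_product (carrier H) U U' x \<one>\<^bsub>K\<^esub> = (if x = \<one>\<^bsub>G\<^esub> then 1 else 0)"
    if "x \<in> carrier G" for x
    using that H by (simp add: one_U)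
  note ip = ip_qls_composition[OF assms(1-4) tm]
  show ?thesis
  proof (rule T.quantum_latin_squareI)
    show "finite (carrier G)" "finite (carrier K)" "card (carrier G) = card (carrier K)"
      using qls by (simp_all add: V.quantum_latin_square_def W.quantum_latin_square_def)
    show "carrier G \<noteq> {}"
      by blast
    show "ipT (?\<Phi> a c) (?\<Phi> a c') = (if c = c' then 1 else 0)"
      if "a \<in> carrier G" "c \<in> carrier K" "c' \<in> carrier K" for a c c'
      using that by (simp add: ip row K.inv_mult_eq_one_iff)
    show "ipT (?\<Phi> a c) (?\<Phi> a' c) = (if a = a' then 1 else 0)"
      if "a \<in> carrier G" "a' \<in> carrier G" "c \<in> carrier K" for a a' c
      using that by (simp add: ip col G.inv_mult_eq_one_iff)
  qed (use qls_composition_in_row_span[OF assms] qls_composition_in_column_span[OF assms] in auto)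
qed

end

text \<open>Invariance is implicit in having a transformation matrix: each inner product is the
  value of \<open>U\<close> at the two quotients, so equal quotients give equal inner
  products.\<close>

lemma (in complex_inner_product_space) invariant_quantum_latin_squareI:
  assumes "group G" "group H" "quantum_latin_square (carrier G) (carrier H) \<psi>"
    and "transformation_matrix G H \<psi> U"
  shows "invariant_quantum_latin_square G H \<psi>"
  unfolding invariant_quantum_latin_square_def
  using assms transformation_matrixD[OF assms(1,2,4)] by simp

theorem theorem5p3:
  fixes G :: "('g, 'm) monoid_scheme" and G' :: "('h, 'n) monoid_scheme"
    and G'' :: "('k, 'o) monoid_scheme"
    and scaleV :: "complex \<Rightarrow> 'v::ab_group_add \<Rightarrow> 'v" and ipV :: "'v \<Rightarrow> 'v \<Rightarrow> complex"
    and scaleW :: "complex \<Rightarrow> 'w::ab_group_add \<Rightarrow> 'w" and ipW :: "'w \<Rightarrow> 'w \<Rightarrow> complex"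
    and scaleT :: "complex \<Rightarrow> 't::ab_group_add \<Rightarrow> 't" and ipT :: "'t \<Rightarrow> 't \<Rightarrow> complex"
    and tensor :: "'v \<Rightarrow> 'w \<Rightarrow> 't"
    and \<psi> :: "'g \<Rightarrow> 'h \<Rightarrow> 'v" and \<psi>' :: "'h \<Rightarrow> 'k \<Rightarrow> 'w"
    and U :: "'g \<Rightarrow> 'h \<Rightarrow> complex" and U' :: "'h \<Rightarrow> 'k \<Rightarrow> complex"
  assumes "inner_product_tensor scaleV ipV scaleW ipW scaleT ipT tensor"
    and "group G" and "finite (carrier G)"
    and "group G'" and "finite (carrier G')"
    and "group G''" and "finite (carrier G'')"
    and "complex_inner_product_space.invariant_quantum_latin_square scaleV ipV G G' \<psi>"
    and "complex_inner_product_space.invariant_quantum_latin_square scaleW ipW G' G'' \<psi>'"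
    and "complex_inner_product_space.transformation_matrix ipV G G' \<psi> U"
    and "complex_inner_product_space.transformation_matrix ipW G' G'' \<psi>' U'"
  shows "complex_inner_product_space.invariant_quantum_latin_square scaleT ipT G G''
           (qls_composition scaleT tensor (carrier G') \<psi> \<psi>') \<and>
         complex_inner_product_space.transformation_matrix ipT G G''
           (qls_composition scaleT tensor (carrier G') \<psi> \<psi>') (matrix_product (carrier G') U U')"
proof -
  interpret inner_product_tensor scaleV ipV scaleW ipW scaleT ipT tensor
    by fact
  have qls: "V.quantum_latin_square (carrier G) (carrier G') \<psi>"
    "W.quantum_latin_square (carrier G') (carrier G'') \<psi>'"
    using assms(8,9)
    by (simp_all add: V.invariant_quantum_latin_square_def W.invariant_quantum_latin_square_def)
  have "T.quantum_latin_square (carrier G) (carrier G'')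
      (qls_composition scaleT tensor (carrier G') \<psi> \<psi>')"
    by (rule quantum_latin_square_qls_composition[OF assms(2,4,5,6) qls assms(10,11)])
  moreover have "T.transformation_matrix G G''
      (qls_composition scaleT tensor (carrier G') \<psi> \<psi>') (matrix_product (carrier G') U U')"
    by (rule transformation_matrix_qls_composition[OF assms(2,4,5,6,10,11)])
  ultimately show ?thesis
    using T.invariant_quantum_latin_squareI[OF assms(2,6)] by blast
qed

end
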